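(* Let $B$ be a multi-set of $n$ bids in $I^\gamma$ all belonging to three consecutive sites, that is, $|b-\tilde b|\le2\gamma$ for all $b,\tilde b\in B$. Let $\hat B,\check B$ be the two classes of $B$ under the relation $b\sim b'\iff |b-b'|/\gamma$ is even (so $\hat B\cup\check B=B$). Let $p\in[0,1]$ be such that $w=pn\in\mathbb{N}$ is the number of winners and $\ell=(1-p)n\in\mathbb{N}$ is the number of losers at each step. (a) (Bulk periodicity.) Assume that for all $k\in\{0,\dots,w+\ell\}$ one has $(T^\gamma)^kB\cap\{0,1\}=\emptyset$. Then $$(T^\gamma)^KB=B+\gamma\cdot\frac{w-\ell}{w+\ell}\cdot K,$$ where $K=\dfrac{w+\ell}{\gcd(w,\ell)}$ if $|\hat B|\ne|\check B|$, and, if $|\hat B|=|\check B|$, $$K=\begin{cases}\dfrac{w+\ell}{\gcd(w,\ell)} & \text{if }\dfrac{w+\ell}{\gcd(w,\ell)}\text{ is odd},\\[2mm] \dfrac{w+\ell}{2\gcd(w,\ell)} & \text{if }\dfrac{w+\ell}{\gcd(w,\ell)}\text{ is even}.\end{cases}$$ (b) (Boundary behavior.) If $w<\ell$, the configuration $[0,\dots,0,\gamma,\dots,\gamma]$ with $\ell$ bids at $0$ and $w$ bids at $\gamma$ is conserved by $T^\gamma$. If $w>\ell$, the configuration $[1-\gamma,\dots,1-\gamma,1,\dots,1]$ with $\ell$ bids at $1-\gamma$ and $w$ bids at $1$ is conserved by $T^\gamma$.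
   Context: $\gamma$ is the inverse of a natural number, $I^\gamma=[0,1]\cap\gamma\mathbb{N}$ (with $0\in I^\gamma$). Multi-sets are written with square brackets, and $[b_1,\dots,b_n]+a=[b_1+a,\dots,b_n+a]$. For a multi-set $B$ of $n$ elements of $I^\gamma$ let $b'_1\le\dots\le b'_n$ be its ordered elements. One step $T^\gamma B$ of the dynamics: the $np$ lowest bids $b'_1,\dots,b'_{np}$ (winners) are increased by $\gamma$ and the remaining bids (losers) are decreased by $\gamma$, with the boundary conditions that bids stay in $[0,1]$: a winner at $1$ stays at $1$ and a loser at $0$ stays at $0$. *)

theory Defs
  imports Complex_Main "HOL-Library.Multiset"
begin

definition bid_grid :: "real \<Rightarrow> real set" where
  "bid_grid \<gamma> = {0..1} \<inter> {\<gamma> * real k | k. True}"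

text \<open>
  One step of the dynamics. The number of winners is \<open>p * size B\<close>; the floor is only a
  conversion from \<open>real\<close> to \<open>nat\<close>, as \<open>p * size B\<close> is meant to be a natural number.
  For bids in \<open>bid_grid \<gamma>\<close>, with \<open>\<gamma>\<close> the inverse of a natural number, the \<open>min\<close> and
  \<open>max\<close> only affect winners at \<open>1\<close> and losers at \<open>0\<close>, which stay where they are.
\<close>

definition bid_step :: "real \<Rightarrow> real \<Rightarrow> real multiset \<Rightarrow> real multiset" where
  "bid_step \<gamma> p B =
     (let bs = sorted_list_of_multiset B;
          w = nat \<lfloor>p * real (size B)\<rfloor>
      in mset (map (\<lambda>b. min 1 (b + \<gamma>)) (take w bs)) +
         mset (map (\<lambda>b. max 0 (b - \<gamma>)) (drop w bs)))"

definition same_parity :: "real \<Rightarrow> real \<Rightarrow> real \<Rightarrow> bool" where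
  "same_parity \<gamma> b b' \<longleftrightarrow> (\<exists>m::int. even m \<and> \<bar>b - b'\<bar> / \<gamma> = of_int m)"

text \<open>
  \<open>B1\<close> and \<open>B2\<close> are the two classes of \<open>B\<close> under \<open>same_parity \<gamma>\<close>, with multiplicities;
  one of them is empty if all bids are equivalent.
\<close>

definition parity_classes ::
    "real \<Rightarrow> real multiset \<Rightarrow> real multiset \<Rightarrow> real multiset \<Rightarrow> bool" where
  "parity_classes \<gamma> B B1 B2 \<longleftrightarrow>
     B1 + B2 = B \<and>
     (\<forall>b\<in>#B1. \<forall>b'\<in>#B1. same_parity \<gamma> b b') \<and>
     (\<forall>b\<in>#B2. \<forall>b'\<in>#B2. same_parity \<gamma> b b') \<and>
     (\<forall>b\<in>#B1. \<forall>b'\<in>#B2. \<not> same_parity \<gamma> b b')"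

definition period :: "nat \<Rightarrow> nat \<Rightarrow> nat \<Rightarrow> nat \<Rightarrow> nat" where
  "period w l c1 c2 =
     (if c1 \<noteq> c2 \<or> odd ((w + l) div gcd w l)
      then (w + l) div gcd w l
      else (w + l) div (2 * gcd w l))"

end

theory Submission
  imports Defs
begin

text \<open>
  In the frame moving with velocity \<open>-\<gamma>\<close> per step, losers rest and winners move by \<open>2 \<gamma>\<close>. As all
  bids lie within \<open>2 \<gamma>\<close> of each other, the winners then become the highest bids in unchanged order,
  so one step rotates the sorted list of bids by \<open>w\<close> places. Continuing the sorted list to a
  sequence \<open>s\<close> with \<open>s (i + n) = s i + 2 \<gamma>\<close>, the state after \<open>k\<close> steps is the window
  \<open>s (k w), \<dots>, s (k w + n - 1)\<close> shifted by \<open>-k \<gamma>\<close>, and a period occurs when \<open>k w\<close> is a multiple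
  of \<open>n\<close>. If the two parity classes have the same size, then even \<open>s (i + n / 2) = s i + \<gamma>\<close>, and
  multiples of \<open>n / 2\<close> suffice.
\<close>

section \<open>The unrolled sequence of bids\<close>

text \<open>The sequence \<open>s\<close> from above, for \<open>n = length xs\<close>: the
  remainder selects the bid, the quotient counts the completed rounds.\<close>

definition unrolled :: "real \<Rightarrow> real list \<Rightarrow> nat \<Rightarrow> real" where
  "unrolled \<gamma> xs i = xs ! (i mod length xs) + 2 * \<gamma> * real (i div length xs)"

lemma unrolled_less_length [simp]: "i < length xs \<Longrightarrow> unrolled \<gamma> xs i = xs ! i"
  by (simp add: unrolled_def)

lemma unrolled_add_length:
  "xs \<noteq> [] \<Longrightarrow> unrolled \<gamma> xs (i + length xs) = unrolled \<gamma> xs i + 2 * \<gamma>"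
  by (simp add: unrolled_def algebra_simps)

text \<open>Inside a round this is sortedness. At the passage from the last bid to the first,
  closeness bounds the drop by \<open>2 * \<gamma>\<close>, which is exactly what the new round
  adds.\<close>

lemma mono_unrolled:
  assumes "sorted xs" "xs \<noteq> []"
    and close: "\<And>x y. x \<in> set xs \<Longrightarrow> y \<in> set xs \<Longrightarrow> \<bar>x - y\<bar> \<le> 2 * \<gamma>"
  shows "mono (unrolled \<gamma> xs)"
  unfolding mono_iff_le_Suc
proof
  fix i
  let ?n = "length xs"
  have n: "?n > 0" using assms by simp
  show "unrolled \<gamma> xs i \<le> unrolled \<gamma> xs (Suc i)"
  proof (cases "Suc (i mod ?n) = ?n")
    case True
    have "\<bar>xs ! (i mod ?n) - xs ! 0\<bar> \<le> 2 * \<gamma>"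
      using n by (intro close nth_mem) auto
    then show ?thesis
      using True by (simp add: unrolled_def mod_Suc div_Suc algebra_simps)
  next
    case False
    then have "Suc (i mod ?n) < ?n"
      using n mod_less_divisor[of ?n i] by linarith
    then have "xs ! (i mod ?n) \<le> xs ! Suc (i mod ?n)"
      using \<open>sorted xs\<close> by (intro sorted_nth_mono) auto
    then show ?thesis
      using False by (simp add: unrolled_def mod_Suc div_Suc)
  qed
qed

text \<open>Serves both translation rules: \<open>m = n\<close>, \<open>c = 2 * \<gamma>\<close> in
  general, and \<open>m = n / 2\<close>, \<open>c = \<gamma>\<close> for parity classes of equal
  size.\<close>

lemma unrolled_add_mult:
  assumes "\<And>i. unrolled \<gamma> xs (i + m) = unrolled \<gamma> xs i + c"
  shows "unrolled \<gamma> xs (i + q * m) = unrolled \<gamma> xs i + real q * c"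
proof (induction q)
  case (Suc q)
  then show ?case
    using assms[of "i + q * m"] by (simp add: algebra_simps)
qed simp

section \<open>The grid and a single step\<close>

text \<open>Here \<open>b = \<gamma> * m\<close> with \<open>0 < m < N\<close>. The bounds make the
  \<open>min\<close> and \<open>max\<close> in \<open>bid_step\<close> inactive at bids other than
  \<open>0\<close> and \<open>1\<close>.\<close>

lemma bid_grid_interior:
  assumes "N > 0" "\<gamma> = 1 / real N" "b \<in> bid_grid \<gamma>" "b \<noteq> 0" "b \<noteq> 1"
  shows "\<gamma> \<le> b" "b \<le> 1 - \<gamma>"
proof -
  obtain m where m: "b = \<gamma> * real m" and b: "0 \<le> b" "b \<le> 1"
    using assms by (auto simp: bid_grid_def)
  have "m > 0" using m assms by (cases m) auto
  then show "\<gamma> \<le> b" using mult_left_mono[of 1 "real m" \<gamma>] assms(2) m by simp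
  have "real m \<le> real N" using m b assms(1,2) by (simp add: divide_le_eq)
  then have "m \<le> N" by simp
  moreover have "m \<noteq> N" using m assms by auto
  ultimately have "real m + 1 \<le> real N" by linarith
  then have "\<gamma> * (real m + 1) \<le> \<gamma> * real N"
    using assms(2) by (intro mult_left_mono) auto
  then show "b \<le> 1 - \<gamma>" using assms(1,2) m by (simp add: distrib_left)
qed

text \<open>The clamps can only produce \<open>0\<close> and \<open>1\<close>, and
  \<open>1 = \<gamma> * N\<close> is a grid point too.\<close>

lemma bid_grid_neighbours:
  assumes "N > 0" "\<gamma> = 1 / real N" "b \<in> bid_grid \<gamma>"
  shows "min 1 (b + \<gamma>) \<in> bid_grid \<gamma>" "max 0 (b - \<gamma>) \<in> bid_grid \<gamma>"
proof -
  obtain m where m: "b = \<gamma> * real m" and b: "0 \<le> b" "b \<le> 1"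
    using assms by (auto simp: bid_grid_def)
  have \<gamma>: "\<gamma> > 0" "1 = \<gamma> * real N" using assms by auto
  have "b + \<gamma> = \<gamma> * real (Suc m)" using m by (simp add: algebra_simps)
  then have "\<exists>k. min 1 (b + \<gamma>) = \<gamma> * real k" using \<gamma>(2) unfolding min_def by metis
  then show "min 1 (b + \<gamma>) \<in> bid_grid \<gamma>"
    using b \<gamma>(1) by (auto simp: bid_grid_def)
  have "\<exists>k. max 0 (b - \<gamma>) = \<gamma> * real k"
  proof (cases m)
    case 0
    then show ?thesis using m \<gamma>(1) by (intro exI[of _ 0]) simp
  next
    case (Suc j)
    then show ?thesis using m \<gamma>(1) by (intro exI[of _ j]) (simp add: algebra_simps)
  qed
  then show "max 0 (b - \<gamma>) \<in> bid_grid \<gamma>"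
    using b \<gamma>(1) by (auto simp: bid_grid_def)
qed

lemma bid_step_sorted:
  assumes "sorted xs" "real w = p * real (length xs)"
  shows "bid_step \<gamma> p (mset xs) =
    mset (map (\<lambda>b. min 1 (b + \<gamma>)) (take w xs)) + mset (map (\<lambda>b. max 0 (b - \<gamma>)) (drop w xs))"
proof -
  have "nat \<lfloor>p * real (length xs)\<rfloor> = w"
    unfolding assms(2)[symmetric] by simp
  then show ?thesis
    using assms(1) by (simp add: bid_step_def Let_def sorted_sort_id)
qed

lemma bid_step_subset_bid_grid:
  assumes "N > 0" "\<gamma> = 1 / real N" "set_mset B \<subseteq> bid_grid \<gamma>"
  shows "set_mset (bid_step \<gamma> p B) \<subseteq> bid_grid \<gamma>"
proof -
  let ?xs = "sorted_list_of_multiset B"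
  have "set ?xs \<subseteq> bid_grid \<gamma>" using assms by simp
  then have "set (take m ?xs) \<subseteq> bid_grid \<gamma>" "set (drop m ?xs) \<subseteq> bid_grid \<gamma>" for m
    using set_take_subset set_drop_subset by fast+
  then show ?thesis
    using bid_grid_neighbours[OF assms(1,2)] by (fastforce simp: bid_step_def Let_def)
qed

section \<open>The dynamics as a moving window\<close>

text \<open>A winner satisfies \<open>s i - c + \<gamma> = s (i + n) - (c + \<gamma>)\<close>, so it
  reappears \<open>n\<close> places later, directly behind the losers, which keep their indices. The
  window thus advances by \<open>w\<close>.\<close>

lemma bid_step_window:
  fixes s :: "nat \<Rightarrow> real"
  assumes s: "mono s" "\<And>i. s (i + n) = s i + 2 * \<gamma>"
    and w: "real w = p * real n" "w \<le> n"
    and interior: "\<And>i. a \<le> i \<Longrightarrow> i < a + n \<Longrightarrow> \<gamma> \<le> s i - c \<and> s i - c \<le> 1 - \<gamma>"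
  shows "bid_step \<gamma> p (mset (map (\<lambda>i. s i - c) [a..<a + n])) =
    mset (map (\<lambda>i. s i - (c + \<gamma>)) [a + w..<a + w + n])"
proof -
  let ?xs = "map (\<lambda>i. s i - c) [a..<a + n]"
  have "sorted ?xs"
    unfolding sorted_iff_nth_mono using monoD[OF s(1)] by simp
  then have "bid_step \<gamma> p (mset ?xs) =
      mset (map (\<lambda>b. min 1 (b + \<gamma>)) (take w ?xs)) + mset (map (\<lambda>b. max 0 (b - \<gamma>)) (drop w ?xs))"
    using w by (intro bid_step_sorted) auto
  also have "map (\<lambda>b. min 1 (b + \<gamma>)) (take w ?xs) =
      map (\<lambda>i. s (i + n) - (c + \<gamma>)) [a..<a + w]"
  proof -
    have "min 1 (s i - c + \<gamma>) = s (i + n) - (c + \<gamma>)" if "i \<in> set [a..<a + w]" for i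
      using interior[of i] that w(2) by (simp add: s(2))
    then show ?thesis
      using w(2) by (simp add: take_map take_upt)
  qed
  also have "\<dots> = map (\<lambda>i. s i - (c + \<gamma>)) [a + n..<a + w + n]"
    by (rule nth_equalityI) (auto simp: add_ac)
  also have "map (\<lambda>b. max 0 (b - \<gamma>)) (drop w ?xs) =
      map (\<lambda>i. s i - (c + \<gamma>)) [a + w..<a + n]"
  proof -
    have "max 0 (s i - c - \<gamma>) = s i - (c + \<gamma>)" if "i \<in> set [a + w..<a + n]" for i
      using interior[of i] that by simp
    then show ?thesis
      by (simp add: drop_map drop_upt)
  qed
  also have "mset (map (\<lambda>i. s i - (c + \<gamma>)) [a + n..<a + w + n]) +
      mset (map (\<lambda>i. s i - (c + \<gamma>)) [a + w..<a + n]) =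
      mset (map (\<lambda>i. s i - (c + \<gamma>)) ([a + w..<a + n] @ [a + n..<a + w + n]))"
    by (simp only: map_append mset_append add.commute)
  also have "[a + w..<a + n] @ [a + n..<a + w + n] = [a + w..<a + w + n]"
    using w(2) upt_add_eq_append[of "a + w" "a + n" w] by (simp add: add_ac)
  finally show ?thesis .
qed

lemma bid_step_funpow_window:
  assumes N: "N > 0" "\<gamma> = 1 / real N"
    and xs: "sorted xs" "xs \<noteq> []" "set xs \<subseteq> bid_grid \<gamma>"
    and close: "\<And>x y. x \<in> set xs \<Longrightarrow> y \<in> set xs \<Longrightarrow> \<bar>x - y\<bar> \<le> 2 * \<gamma>"
    and w: "real w = p * real (length xs)" "w \<le> length xs"
    and bulk: "\<And>k. k < K \<Longrightarrow> set_mset ((bid_step \<gamma> p ^^ k) (mset xs)) \<inter> {0, 1} = {}"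
  shows "(bid_step \<gamma> p ^^ K) (mset xs) =
    mset (map (\<lambda>i. unrolled \<gamma> xs i - \<gamma> * real K) [K * w..<K * w + length xs])"
  using bulk
proof (induction K)
  case 0
  have "map (unrolled \<gamma> xs) [0..<length xs] = xs"
    by (rule nth_equalityI) auto
  then show ?case by simp
next
  case (Suc K)
  let ?s = "unrolled \<gamma> xs"
  have state: "(bid_step \<gamma> p ^^ K) (mset xs) =
      mset (map (\<lambda>i. ?s i - \<gamma> * real K) [K * w..<K * w + length xs])"
    using Suc by auto
  have "set_mset ((bid_step \<gamma> p ^^ k) (mset xs)) \<subseteq> bid_grid \<gamma>" for k
    using xs(3) bid_step_subset_bid_grid[OF N] by (induction k) auto
  note grid = this[of K]
  \<comment> \<open>No bid of the current state touches the boundary, so the next step is free of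
    clamping; this is why \<open>bulk\<close> is assumed for all \<open>k < K\<close>.\<close>
  have "\<gamma> \<le> ?s i - \<gamma> * real K \<and> ?s i - \<gamma> * real K \<le> 1 - \<gamma>"
    if "K * w \<le> i" "i < K * w + length xs" for i
  proof -
    have "?s i - \<gamma> * real K \<in># (bid_step \<gamma> p ^^ K) (mset xs)"
      unfolding state using that by auto
    then have "?s i - \<gamma> * real K \<in> bid_grid \<gamma>" "?s i - \<gamma> * real K \<noteq> 0" "?s i - \<gamma> * real K \<noteq> 1"
      using grid Suc.prems[of K] by blast+
    then show ?thesis
      using bid_grid_interior[OF N] by blast
  qed
  then have "bid_step \<gamma> p (mset (map (\<lambda>i. ?s i - \<gamma> * real K) [K * w..<K * w + length xs])) =
      mset (map (\<lambda>i. ?s i - (\<gamma> * real K + \<gamma>)) [K * w + w..<K * w + w + length xs])"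
    using w xs close by (intro bid_step_window mono_unrolled unrolled_add_length) auto
  then show ?case
    by (simp add: state algebra_simps)
qed

text \<open>If advancing by \<open>K * w\<close> indices raises \<open>s\<close> by the constant
  \<open>c\<close>, the window is the initial one raised by \<open>c\<close>, while the moving frame
  has lowered it by \<open>\<gamma> * K\<close>.\<close>

lemma bid_step_funpow_shift:
  assumes N: "N > 0" "\<gamma> = 1 / real N"
    and xs: "sorted xs" "xs \<noteq> []" "set xs \<subseteq> bid_grid \<gamma>"
    and close: "\<And>x y. x \<in> set xs \<Longrightarrow> y \<in> set xs \<Longrightarrow> \<bar>x - y\<bar> \<le> 2 * \<gamma>"
    and w: "real w = p * real (length xs)" "w \<le> length xs"
    and bulk: "\<And>k. k < K \<Longrightarrow> set_mset ((bid_step \<gamma> p ^^ k) (mset xs)) \<inter> {0, 1} = {}"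
    and shift: "\<And>i. unrolled \<gamma> xs (i + K * w) = unrolled \<gamma> xs i + c"
  shows "(bid_step \<gamma> p ^^ K) (mset xs) = image_mset (\<lambda>b. b + (c - \<gamma> * real K)) (mset xs)"
proof -
  have "map (\<lambda>i. unrolled \<gamma> xs i - \<gamma> * real K) [K * w..<K * w + length xs] =
      map (\<lambda>b. b + (c - \<gamma> * real K)) xs"
    using shift by (intro nth_equalityI) (auto simp: add.commute[of "K * w"])
  then show ?thesis
    using bid_step_funpow_window[OF N xs close w bulk] by (simp flip: mset_map)
qed

section \<open>Parity classes of equal size\<close>

lemma same_parity_refl: "same_parity \<gamma> b b"
  unfolding same_parity_def by (rule exI[of _ 0]) simp

lemma same_parity_sym: "same_parity \<gamma> b b' \<longleftrightarrow> same_parity \<gamma> b' b"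
  by (simp add: same_parity_def abs_minus_commute)

text \<open>All positions in \<open>J\<close> carry bids equivalent to \<open>b\<close>, and these
  come from the single class containing \<open>b\<close>.\<close>

lemma parity_class_bound:
  assumes cl: "parity_classes \<gamma> (mset xs) B1 B2" "size B1 = h" "size B2 = h"
    and J: "J \<subseteq> {..<length xs}" "b \<in> set xs" "\<And>j. j \<in> J \<Longrightarrow> same_parity \<gamma> b (xs ! j)"
  shows "card J \<le> h"
proof -
  let ?P = "same_parity \<gamma> b"
  have "card J \<le> card {j. j < length xs \<and> ?P (xs ! j)}"
    using J by (intro card_mono) auto
  also have "\<dots> = size (filter_mset ?P (mset xs))"
    by (simp add: length_filter_conv_card flip: mset_filter)
  also have "\<dots> = size (filter_mset ?P B1) + size (filter_mset ?P B2)"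
    using cl(1) by (metis parity_classes_def filter_union_mset size_union)
  also have "\<dots> \<le> h"
  proof -
    have "b \<in># B1 + B2" using J(2) cl(1) by (simp add: parity_classes_def)
    \<comment> \<open>The class that does not contain \<open>b\<close> has no bid equivalent to
      \<open>b\<close>.\<close>
    then have "filter_mset ?P B1 = {#} \<or> filter_mset ?P B2 = {#}"
      using cl(1) same_parity_sym
      unfolding parity_classes_def filter_mset_eq_mempty_iff union_iff by blast
    then show ?thesis
      using cl(2,3) size_filter_mset_lesseq[of ?P B1] size_filter_mset_lesseq[of ?P B2]
      by (elim disjE) (simp_all del: filter_mset_eq_mempty_iff)
  qed
  finally show ?thesis .
qed

text \<open>If \<open>xs ! i\<close> and \<open>xs ! (i + h)\<close> differed by \<open>0\<close> or \<open>2 \<gamma>\<close>, then \<open>h + 1\<close> bids would have equal parity.\<close>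

lemma sorted_nth_add_half:
  assumes \<gamma>: "\<gamma> > 0"
    and xs: "sorted xs" "set xs \<subseteq> bid_grid \<gamma>"
    and close: "\<And>x y. x \<in> set xs \<Longrightarrow> y \<in> set xs \<Longrightarrow> \<bar>x - y\<bar> \<le> 2 * \<gamma>"
    and cl: "parity_classes \<gamma> (mset xs) B1 B2" "size B1 = h" "size B2 = h"
    and i: "i < h"
  shows "xs ! (i + h) = xs ! i + \<gamma>"
proof -
  have len: "length xs = 2 * h"
    using cl by (metis parity_classes_def size_mset size_union mult_2)
  have mem: "xs ! j \<in> set xs" if "j < 2 * h" for j using that len by simp
  have mono: "xs ! j \<le> xs ! k" if "j \<le> k" "k < 2 * h" for j k
    using sorted_nth_mono[OF xs(1)] that len by simp
  have near: "xs ! k - xs ! j \<le> 2 * \<gamma>" if "j < 2 * h" "k < 2 * h" for j k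
    using close[of "xs ! k" "xs ! j"] mem that by fastforce
  obtain m1 m2 where m: "xs ! i = \<gamma> * real m1" "xs ! (i + h) = \<gamma> * real m2"
    using xs(2) mem[of i] mem[of "i + h"] i unfolding bid_grid_def by fastforce
  have "xs ! i \<le> xs ! (i + h)" "xs ! (i + h) - xs ! i \<le> 2 * \<gamma>"
    using mono[of i "i + h"] near i by auto
  then have "\<gamma> * real m1 \<le> \<gamma> * real m2" "\<gamma> * real m2 \<le> \<gamma> * real (m1 + 2)"
    unfolding m by (simp_all add: algebra_simps)
  then have "m1 \<le> m2" "m2 \<le> m1 + 2"
    using \<gamma> by (simp_all only: mult_le_cancel_left_pos of_nat_le_iff)
  then consider "m2 = m1" | "m2 = m1 + 1" | "m2 = m1 + 2" by linarith
  then show ?thesis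
  proof cases
    case 1
    \<comment> \<open>Sortedness squeezes all \<open>h + 1\<close> bids between the two equal
      ones.\<close>
    have "xs ! j = xs ! i" if "j \<in> {i..i + h}" for j
      using mono[of i j] mono[of j "i + h"] that i m 1 by auto
    then have "same_parity \<gamma> (xs ! i) (xs ! j)" if "j \<in> {i..i + h}" for j
      using that same_parity_refl by metis
    then have "card {i..i + h} \<le> h"
      using i len mem[of i] by (intro parity_class_bound[OF cl, of _ "xs ! i"]) auto
    then show ?thesis by simp
  next
    case 2
    then show ?thesis using m by (simp add: algebra_simps)
  next
    case 3
    have *: "xs ! (i + h) = xs ! i + 2 * \<gamma>" using m 3 by (simp add: algebra_simps)
    \<comment> \<open>The maximal spread is attained, so bids up to \<open>i\<close> are lowest and
      bids from \<open>i + h\<close> on are highest. These are \<open>i + 1\<close> and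
      \<open>h - i\<close> bids, again \<open>h + 1\<close> of one parity.\<close>
    have low: "xs ! j = xs ! i" if "j \<le> i" for j
      using mono[of j i] near[of j "i + h"] that i * by auto
    have high: "xs ! j = xs ! i + 2 * \<gamma>" if "j \<in> {i + h..<2 * h}" for j
      using mono[of "i + h" j] near[of i j] that i * by auto
    have "same_parity \<gamma> (xs ! i) (xs ! j)" if "j \<in> {..i} \<union> {i + h..<2 * h}" for j
    proof -
      have "same_parity \<gamma> (xs ! i) (xs ! i + 2 * \<gamma>)"
        unfolding same_parity_def using \<gamma> by (intro exI[of _ 2]) simp
      then show ?thesis
        using that low high same_parity_refl by (metis UnE atMost_iff)
    qed
    then have "card ({..i} \<union> {i + h..<2 * h}) \<le> h"
      using i len mem[of i]
      by (intro parity_class_bound[OF cl, of _ "xs ! i"]) auto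
    moreover have "card ({..i} \<union> {i + h..<2 * h}) = h + 1"
      using i by (subst card_Un_disjoint) auto
    ultimately show ?thesis by simp
  qed
qed

text \<open>In the second half of a round, two half-rounds add \<open>2 * \<gamma>\<close>, of which
  the first has used \<open>\<gamma>\<close>. Adding full rounds extends this to all
  indices.\<close>

lemma unrolled_add_half:
  assumes len: "length xs = 2 * h" "xs \<noteq> []"
    and half: "\<And>i. i < h \<Longrightarrow> xs ! (i + h) = xs ! i + \<gamma>"
  shows "unrolled \<gamma> xs (i + h) = unrolled \<gamma> xs i + \<gamma>"
proof -
  let ?s = "unrolled \<gamma> xs"
  have low: "?s (j + h) = ?s j + \<gamma>" if "j < 2 * h" for j
  proof (cases "j < h")
    case True
    then show ?thesis using half len by simp
  next
    case False
    then obtain j' where j': "j = j' + h" by (metis add.commute le_Suc_ex not_le)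
    then have "?s (j + h) = ?s (j' + length xs)" using len by (simp add: mult_2 add_ac)
    also have "\<dots> = ?s j + \<gamma>"
      using half[of j'] that j' len unfolding unrolled_add_length[OF len(2)] by simp
    finally show ?thesis .
  qed
  have *: "?s (j + q * length xs) = ?s j + real q * (2 * \<gamma>)" for j q
    by (intro unrolled_add_mult unrolled_add_length len(2))
  have "i = i mod length xs + i div length xs * length xs" by simp
  then obtain j q where i: "i = j + q * length xs" "j < 2 * h"
    using len by (metis length_greater_0_conv mod_less_divisor)
  have "?s (i + h) = ?s ((j + h) + q * length xs)" using i by (simp add: add_ac)
  then show ?thesis using i low[of j] by (simp only: *)
qed

section \<open>Bulk periodicity\<close>

text \<open>Write \<open>w = u * g\<close> and \<open>l = v * g\<close> with \<open>g\<close> the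
  gcd. Then \<open>K * w\<close> equals \<open>u\<close> full rounds if \<open>K = u + v\<close>,
  and \<open>u\<close> half-rounds if \<open>K = (u + v) / 2\<close>.\<close>

lemma bulk_periodicity:
  assumes N: "N > 0" "\<gamma> = 1 / real N"
    and w: "real w = p * real (size B)" and l: "w + l = size B"
    and grid: "set_mset B \<subseteq> bid_grid \<gamma>"
    and close: "\<And>b b'. b \<in># B \<Longrightarrow> b' \<in># B \<Longrightarrow> \<bar>b - b'\<bar> \<le> 2 * \<gamma>"
    and cl: "parity_classes \<gamma> B B1 B2"
    and bulk: "\<And>k. k \<le> w + l \<Longrightarrow> set_mset ((bid_step \<gamma> p ^^ k) B) \<inter> {0, 1} = {}"
    and K: "K = period w l (size B1) (size B2)"
  shows "(bid_step \<gamma> p ^^ K) B =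
    image_mset (\<lambda>b. b + \<gamma> * ((real w - real l) / (real w + real l)) * real K) B"
proof (cases "B = {#}")
  case True
  \<comment> \<open>Without bids \<open>w + l = 0\<close>, hence \<open>K = 0\<close>.\<close>
  then show ?thesis using l K by (simp add: period_def)
next
  case False
  define xs where "xs = sorted_list_of_multiset B"
  define g where "g = gcd w l"
  have B: "B = mset xs" and sorted: "sorted xs" by (simp_all add: xs_def)
  then have len: "length xs = w + l" and ne: "xs \<noteq> []" using l False by auto
  then have pos: "w + l > 0" by (metis length_greater_0_conv)
  then have "g > 0" by (auto simp: g_def)
  obtain u v where uv: "w = u * g" "l = v * g"
    using gcd_coprime_exists[of w l] \<open>g > 0\<close> unfolding g_def by blast
  have n: "w + l = (u + v) * g" by (simp add: uv algebra_simps)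
  have quot: "(w + l) div g = u + v" using n \<open>g > 0\<close> by simp
  then have period: "K =
      (if size B1 \<noteq> size B2 \<or> odd (u + v) then u + v else (w + l) div (2 * g))"
    unfolding K period_def g_def by presburger
  have "K \<le> w + l"
    unfolding K period_def by (simp only: div_le_dividend simp_thms split: if_split)
  then have bulk': "\<And>k. k < K \<Longrightarrow> set_mset ((bid_step \<gamma> p ^^ k) (mset xs)) \<inter> {0, 1} = {}"
    using bulk B by simp
  \<comment> \<open>The condition on \<open>c\<close> says that \<open>s\<close> rises over
    \<open>K * w\<close> indices at its mean slope \<open>2 * \<gamma> / n\<close>. Subtracting
    \<open>\<gamma> * K\<close> then gives the claimed velocity.\<close>
  have main: ?thesis if shift: "\<And>i. unrolled \<gamma> xs (i + K * w) = unrolled \<gamma> xs i + c"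
    and c: "c * (real w + real l) = 2 * \<gamma> * real w * real K" for c
  proof -
    have "c - \<gamma> * real K = \<gamma> * ((real w - real l) / (real w + real l)) * real K"
    proof -
      have "real w + real l > 0" using pos by linarith
      then show ?thesis using c by (simp add: field_simps)
    qed
    moreover have "(bid_step \<gamma> p ^^ K) (mset xs) =
        image_mset (\<lambda>b. b + (c - \<gamma> * real K)) (mset xs)"
      using N sorted ne grid close w l B bulk' shift
      by (intro bid_step_funpow_shift) auto
    ultimately show ?thesis using B by simp
  qed
  show ?thesis
  proof (cases "size B1 \<noteq> size B2 \<or> odd (u + v)")
    case True
    then have K': "K = u + v" using period by simp
    have "unrolled \<gamma> xs (i + u * length xs) = unrolled \<gamma> xs i + real u * (2 * \<gamma>)" for i
      by (intro unrolled_add_mult unrolled_add_length ne)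
    moreover have "u * length xs = K * w"
      unfolding len n K' by (simp add: uv)
    ultimately show ?thesis
      by (intro main[of "real u * (2 * \<gamma>)"]) (simp_all add: uv K' algebra_simps)
  next
    case False
    then have "even (u + v)" and sz: "size B2 = size B1" by auto
    then obtain k where k: "u + v = 2 * k" by (elim evenE)
    have "(w + l) div (2 * g) = k"
      using n k \<open>g > 0\<close> by (simp add: ac_simps)
    then have K': "K = k" using period False by simp
    have half: "length xs = 2 * size B1"
      using cl sz B by (metis parity_classes_def size_mset size_union mult_2)
    have "\<gamma> > 0" using N by simp
    then have "xs ! (i + size B1) = xs ! i + \<gamma>" if "i < size B1" for i
      using sorted grid close B sz that by (intro sorted_nth_add_half[OF _ _ _ _ cl[unfolded B]]) auto
    then have "unrolled \<gamma> xs (i + u * size B1) = unrolled \<gamma> xs i + real u * \<gamma>" for i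
      by (intro unrolled_add_mult unrolled_add_half half ne)
    \<comment> \<open>From \<open>2 * size B1 = n = 2 * k * g\<close> follows
      \<open>size B1 = k * g\<close>.\<close>
    moreover have "u * size B1 = K * w"
      using half unfolding len n K' k by (simp add: uv)
    moreover have "real u + real v = 2 * real k" using k by linarith
    then have "real u * \<gamma> * (real w + real l) = 2 * \<gamma> * real w * real K"
      unfolding uv K' by (simp add: algebra_simps flip: distrib_left)
    ultimately show ?thesis
      by (intro main[of "real u * \<gamma>"]) simp_all
  qed
qed

section \<open>The theorem, with the boundary configurations\<close>

theorem lemma3p2:
  fixes \<gamma> p :: real and n w l :: nat
  assumes gamma: "\<exists>N::nat. N > 0 \<and> \<gamma> = 1 / real N"
    and p: "0 \<le> p" "p \<le> 1"
    and w: "real w = p * real n"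
    and l: "real l = (1 - p) * real n"
  shows
    "(\<forall>B B1 B2.
        size B = n \<and>
        set_mset B \<subseteq> bid_grid \<gamma> \<and>
        (\<forall>b\<in>#B. \<forall>b'\<in>#B. \<bar>b - b'\<bar> \<le> 2 * \<gamma>) \<and>
        parity_classes \<gamma> B B1 B2 \<and>
        (\<forall>k\<in>{0..w + l}. set_mset ((bid_step \<gamma> p ^^ k) B) \<inter> {0, 1} = {}) \<longrightarrow>
        (let K = period w l (size B1) (size B2)
         in (bid_step \<gamma> p ^^ K) B =
            image_mset (\<lambda>b. b + \<gamma> * ((real w - real l) / (real w + real l)) * real K) B))
     \<and> (w < l \<longrightarrow>
          bid_step \<gamma> p (replicate_mset l 0 + replicate_mset w \<gamma>) =
          replicate_mset l 0 + replicate_mset w \<gamma>)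
     \<and> (l < w \<longrightarrow>
          bid_step \<gamma> p (replicate_mset l (1 - \<gamma>) + replicate_mset w 1) =
          replicate_mset l (1 - \<gamma>) + replicate_mset w 1)"
proof -
  have replicate_mset_add: "replicate_mset (i + j) x = replicate_mset i x + replicate_mset j x"
    for i j :: nat and x :: real
    by (induction i) simp_all
  obtain N where N: "N > 0" "\<gamma> = 1 / real N" using gamma by auto
  then have \<gamma>: "0 < \<gamma>" "\<gamma> \<le> 1" by auto
  have "real (w + l) = real n" using w l by (simp add: algebra_simps)
  then have n: "w + l = n" by linarith
  have step: "bid_step \<gamma> p (replicate_mset l a + replicate_mset w b) =
      mset (map (\<lambda>b. min 1 (b + \<gamma>)) (take w (replicate l a @ replicate w b))) +
      mset (map (\<lambda>b. max 0 (b - \<gamma>)) (drop w (replicate l a @ replicate w b)))"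
    if "a \<le> b" for a b
    using bid_step_sorted[of "replicate l a @ replicate w b" w p \<gamma>] that w n
    by (auto simp: sorted_append add.commute)
  show ?thesis
  proof (intro conjI allI impI)
    fix B B1 B2
    assume "size B = n \<and>
        set_mset B \<subseteq> bid_grid \<gamma> \<and>
        (\<forall>b\<in>#B. \<forall>b'\<in>#B. \<bar>b - b'\<bar> \<le> 2 * \<gamma>) \<and>
        parity_classes \<gamma> B B1 B2 \<and>
        (\<forall>k\<in>{0..w + l}. set_mset ((bid_step \<gamma> p ^^ k) B) \<inter> {0, 1} = {})"
    then show "let K = period w l (size B1) (size B2)
         in (bid_step \<gamma> p ^^ K) B =
            image_mset (\<lambda>b. b + \<gamma> * ((real w - real l) / (real w + real l)) * real K) B"
      unfolding Let_def using n w
      by (intro bulk_periodicity[OF N _ _ _ _ _ _ refl]) auto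
  next
    assume "w < l"
    \<comment> \<open>Of the bids at \<open>0\<close>, \<open>w\<close> win and rise to
      \<open>\<gamma>\<close> and \<open>d\<close> lose and stay; the \<open>w\<close> bids at
      \<open>\<gamma>\<close> lose and drop to \<open>0\<close>.\<close>
    then obtain d where "l = w + d" by (metis less_imp_add_positive)
    then show "bid_step \<gamma> p (replicate_mset l 0 + replicate_mset w \<gamma>) =
          replicate_mset l 0 + replicate_mset w \<gamma>"
      using \<gamma> by (subst step) (simp_all add: replicate_mset_add add_ac)
  next
    assume "l < w"
    \<comment> \<open>All \<open>l\<close> bids at \<open>1 - \<gamma>\<close> win and rise to
      \<open>1\<close>; of the bids at \<open>1\<close>, \<open>d\<close> win and stay and
      \<open>l\<close> lose and drop to \<open>1 - \<gamma>\<close>.\<close>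
    then obtain d where "w = l + d" by (metis less_imp_add_positive)
    then show "bid_step \<gamma> p (replicate_mset l (1 - \<gamma>) + replicate_mset w 1) =
          replicate_mset l (1 - \<gamma>) + replicate_mset w 1"
      using \<gamma> by (subst step) (simp_all add: replicate_mset_add add_ac)
  qed
qed

end
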